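(* Let $n_o,n_m,p\ge 1$, $n=n_o+n_m$, let $\mathbf{X}_o\in\mathbb{R}^{n_o\times p}$ with $\mathbf{X}_o^T\mathbf{X}_o$ invertible, $\mathbf{X}_m\in\mathbb{R}^{n_m\times p}$ and $\mathbf{Y}_o\in\mathbb{R}^{n_o}$. Consider the regression model with missing responses in which the errors are multivariate normal $\mathrm{MVN}(\mathbf{0},\sigma^2\mathbf{I})$, whose likelihood $L(\boldsymbol\beta,\boldsymbol\beta_m,\sigma)$ is given in the context. Then $\hat{\boldsymbol\beta}=\mathbf{b}_o:=(\mathbf{X}_o^T\mathbf{X}_o)^{-1}\mathbf{X}_o^T\mathbf{Y}_o$ is a maximum likelihood estimate of $\boldsymbol\beta$; that is, for every $\sigma>0$ there is $\hat{\boldsymbol\beta}_m\in\mathbb{R}^{n_m}$ such that $(\mathbf{b}_o,\hat{\boldsymbol\beta}_m)$ maximizes $(\boldsymbol\beta,\boldsymbol\beta_m)\mapsto L(\boldsymbol\beta,\boldsymbol\beta_m,\sigma)$ over $\mathbb{R}^p\times\mathbb{R}^{n_m}$.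
   Context: A response variable has $n$ entries, of which $n_o$ are observed (vector $\mathbf{Y}_o$) and $n_m$ are missing. $\mathbf{X}_o$ and $\mathbf{X}_m$ are the (fully known) covariate matrices, possibly including an intercept column of ones, for the observations with observed and missing response, respectively. The missing responses are replaced by zeros, and an indicator column with entry $-1$ is introduced for each missing value, with coefficient vector $\boldsymbol\beta_m\in\mathbb{R}^{n_m}$ (the missing values treated as parameters). The likelihood is $$L(\boldsymbol\beta,\boldsymbol\beta_m,\sigma)=\frac{1}{(2\pi)^{n/2}\sigma^n}\exp\left(-\frac{1}{2\sigma^2}\left\|\begin{pmatrix}\mathbf{Y}_o\\ \mathbf{0}_{n_m}\end{pmatrix}-\begin{pmatrix}\mathbf{X}_o&\mathbf{0}_{n_o\times n_m}\\ \mathbf{X}_m&-\mathbf{I}_{n_m}\end{pmatrix}\begin{pmatrix}\boldsymbol\beta\\ \boldsymbol\beta_m\end{pmatrix}\right\|^2\right),$$ where $\|\cdot\|$ is the Euclidean norm, $\boldsymbol\beta\in\mathbb{R}^p$, $\sigma>0$. *)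

theory Defs
  imports "HOL-Analysis.Analysis"
begin

text \<open>Blocks are indexed by the disjoint sum of the index types, whose cardinality is the sum of
  the cardinalities.\<close>

definition block_vec :: "'a ^ 'r::finite \<Rightarrow> 'a ^ 's::finite \<Rightarrow> 'a ^ ('r + 's)" where
  "block_vec u v = (\<chi> i. case i of Inl a \<Rightarrow> u $ a | Inr b \<Rightarrow> v $ b)"

text \<open>\<open>block_matrix A B C D\<close> has first block row \<open>A B\<close> and second block row \<open>C D\<close>.\<close>

definition block_matrix ::
  "'a ^ 'c::finite ^ 'r::finite \<Rightarrow> 'a ^ 'd::finite ^ 'r \<Rightarrow> 'a ^ 'c ^ 's::finite \<Rightarrow> 'a ^ 'd ^ 's
    \<Rightarrow> 'a ^ ('c + 'd) ^ ('r + 's)" where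
  "block_matrix A B C D =
    (\<chi> i. case i of Inl a \<Rightarrow> block_vec (A $ a) (B $ a) | Inr b \<Rightarrow> block_vec (C $ b) (D $ b))"

text \<open>Likelihood of the linear model with independent \<open>N(0, \<sigma>\<^sup>2)\<close> errors in which the missing
  responses are replaced by zeros and every missing response gets an indicator column with entry
  \<open>-1\<close>. The index types \<open>'o\<close> and \<open>'m\<close> enumerate the observed and the missing responses, \<open>'p\<close>
  the regression coefficients.\<close>

definition missing_likelihood ::
  "real ^ 'p::finite ^ 'o::finite \<Rightarrow> real ^ 'p ^ 'm::finite \<Rightarrow> real ^ 'o
    \<Rightarrow> real ^ 'p \<Rightarrow> real ^ 'm \<Rightarrow> real \<Rightarrow> real" where
  "missing_likelihood X\<^sub>o X\<^sub>m Y\<^sub>o \<beta> \<beta>\<^sub>m \<sigma> =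
    (let n = CARD('o) + CARD('m) in
      1 / ((2 * pi) powr (real n / 2) * \<sigma> ^ n) *
      exp (- (1 / (2 * \<sigma>\<^sup>2)) *
        (norm (block_vec Y\<^sub>o 0 - block_matrix X\<^sub>o 0 X\<^sub>m (- mat 1) *v block_vec \<beta> \<beta>\<^sub>m))\<^sup>2))"

definition least_squares_estimate :: "real ^ 'p::finite ^ 'o::finite \<Rightarrow> real ^ 'o \<Rightarrow> real ^ 'p" where
  "least_squares_estimate X Y = (matrix_inv (transpose X ** X) ** transpose X) *v Y"

end

theory Submission
  imports Defs
begin

text \<open>The residual splits into an observed block \<open>Y\<^sub>o - X\<^sub>o \<beta>\<close> and a missing block \<open>\<beta>\<^sub>m - X\<^sub>m \<beta>\<close>, whose
  squared norms add up. Whatever \<open>\<beta>\<close> is, the choice \<open>\<beta>\<^sub>m = X\<^sub>m \<beta>\<close> annihilates the missing block,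
  so it remains to minimise the observed one, which least squares does.\<close>

lemma sum_UNIV_Plus:
  "(\<Sum>i\<in>UNIV. f i) = (\<Sum>a\<in>UNIV. f (Inl a)) + (\<Sum>b\<in>UNIV. f (Inr b))"
  for f :: "'a::finite + 'b::finite \<Rightarrow> 'c::comm_monoid_add"
  using sum.Plus[of "UNIV :: 'a set" "UNIV :: 'b set" f] by (simp add: comp_def)

lemma norm_block_vec_power2:
  fixes u :: "real ^ 'r::finite" and v :: "real ^ 's::finite"
  shows "(norm (block_vec u v))\<^sup>2 = (norm u)\<^sup>2 + (norm v)\<^sup>2"
  by (simp add: power2_norm_eq_inner inner_vec_def block_vec_def sum_UNIV_Plus)

lemma block_vec_diff: "block_vec u v - block_vec u' v' = block_vec (u - u') (v - v')"
  by (auto simp: vec_eq_iff block_vec_def split: sum.split)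

lemma block_matrix_vector_mult:
  "block_matrix A B C D *v block_vec x y = block_vec (A *v x + B *v y) (C *v x + D *v y)"
  by (auto simp: vec_eq_iff block_matrix_def block_vec_def matrix_vector_mult_def sum_UNIV_Plus
      split: sum.split)

lemma missing_residual:
  fixes X\<^sub>o :: "real ^ 'p::finite ^ 'o::finite" and X\<^sub>m :: "real ^ 'p ^ 'm::finite"
  shows "block_vec Y\<^sub>o 0 - block_matrix X\<^sub>o 0 X\<^sub>m (- mat 1) *v block_vec \<beta> \<beta>\<^sub>m
    = block_vec (Y\<^sub>o - X\<^sub>o *v \<beta>) (\<beta>\<^sub>m - X\<^sub>m *v \<beta>)"
proof -
  \<comment> \<open>Reading \<open>- mat 1\<close> as \<open>0 - mat 1\<close> makes right
    distributivity applicable.\<close>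
  have "(- mat 1) *v \<beta>\<^sub>m = - \<beta>\<^sub>m"
    using matrix_vector_mult_diff_rdistrib[of 0 "mat 1" \<beta>\<^sub>m] by simp
  then show ?thesis
    by (simp add: block_matrix_vector_mult block_vec_diff)
qed

text \<open>For fixed \<sigma> > 0 the prefactor is a positive constant and the exponent decreases
  in the sum of the two squares, so maximising the likelihood means minimising that sum.\<close>

lemma missing_likelihood_eq:
  fixes X\<^sub>o :: "real ^ 'p::finite ^ 'o::finite" and X\<^sub>m :: "real ^ 'p ^ 'm::finite"
  shows "missing_likelihood X\<^sub>o X\<^sub>m Y\<^sub>o \<beta> \<beta>\<^sub>m \<sigma> =
    1 / ((2 * pi) powr (real (CARD('o) + CARD('m)) / 2) * \<sigma> ^ (CARD('o) + CARD('m))) *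
    exp (- (1 / (2 * \<sigma>\<^sup>2)) * ((norm (Y\<^sub>o - X\<^sub>o *v \<beta>))\<^sup>2 + (norm (\<beta>\<^sub>m - X\<^sub>m *v \<beta>))\<^sup>2))"
  by (simp only: missing_likelihood_def Let_def missing_residual norm_block_vec_power2)

lemma least_squares_normal_equation:
  fixes X :: "real ^ 'p::finite ^ 'o::finite"
  assumes "invertible (transpose X ** X)"
  shows "transpose X *v (Y - X *v least_squares_estimate X Y) = 0"
proof -
  \<comment> \<open>\<open>matrix_inv\<close> is a Hilbert choice; invertibility supplies the
    existence that makes it a genuine inverse.\<close>
  have "(transpose X ** X) ** matrix_inv (transpose X ** X) = mat 1"
    using assms unfolding invertible_def matrix_inv_def by (rule someI2_ex) simp
  then have "(transpose X ** X) *v least_squares_estimate X Y = transpose X *v Y"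
    unfolding least_squares_estimate_def
    by (simp only: matrix_vector_mul_assoc matrix_mul_assoc matrix_mul_lid)
  then show ?thesis
    by (simp add: matrix_vector_mult_diff_distrib matrix_vector_mul_assoc)
qed

text \<open>By the normal equation the least squares residual is orthogonal to the column space of
  \<open>X\<close>, so Pythagoras shows that any other coefficient vector adds a nonnegative
  square.\<close>

lemma least_squares_estimate_minimal:
  fixes X :: "real ^ 'p::finite ^ 'o::finite"
  assumes "invertible (transpose X ** X)"
  shows "(norm (Y - X *v least_squares_estimate X Y))\<^sup>2 \<le> (norm (Y - X *v \<beta>))\<^sup>2"
proof -
  define b where "b = least_squares_estimate X Y"
  \<comment> \<open>Moving \<open>X\<close> across the inner product as its transpose produces the
    left side of the normal equation.\<close>
  have "(Y - X *v b) \<bullet> (X *v (b - \<beta>)) = (transpose X *v (Y - X *v b)) \<bullet> (b - \<beta>)"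
    by (simp only: transpose_matrix_vector dot_lmul_matrix)
  also have "\<dots> = 0"
    using least_squares_normal_equation[OF assms] by (simp add: b_def)
  finally have "orthogonal (Y - X *v b) (X *v (b - \<beta>))"
    by (simp add: orthogonal_def)
  moreover have "Y - X *v \<beta> = (Y - X *v b) + X *v (b - \<beta>)"
    by (simp add: matrix_vector_mult_diff_distrib)
  ultimately have "(norm (Y - X *v \<beta>))\<^sup>2 = (norm (Y - X *v b))\<^sup>2 + (norm (X *v (b - \<beta>)))\<^sup>2"
    by (simp only: norm_add_Pythagorean)
  then show ?thesis
    by (simp add: b_def)
qed

theorem theorem2:
  fixes X\<^sub>o :: "real ^ 'p::finite ^ 'o::finite"
    and X\<^sub>m :: "real ^ 'p ^ 'm::finite"
    and Y\<^sub>o :: "real ^ 'o"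
  assumes "invertible (transpose X\<^sub>o ** X\<^sub>o)"
  shows "\<forall>\<sigma>>0. \<exists>\<beta>\<^sub>m_hat :: real ^ 'm. \<forall>(\<beta> :: real ^ 'p) (\<beta>\<^sub>m :: real ^ 'm).
    missing_likelihood X\<^sub>o X\<^sub>m Y\<^sub>o \<beta> \<beta>\<^sub>m \<sigma>
      \<le> missing_likelihood X\<^sub>o X\<^sub>m Y\<^sub>o (least_squares_estimate X\<^sub>o Y\<^sub>o) \<beta>\<^sub>m_hat \<sigma>"
proof (intro allI impI exI)
  fix \<sigma> :: real and \<beta> :: "real ^ 'p" and \<beta>\<^sub>m :: "real ^ 'm"
  assume "\<sigma> > 0"
  let ?b = "least_squares_estimate X\<^sub>o Y\<^sub>o"
  \<comment> \<open>The witness is the prediction \<open>X\<^sub>m *v ?b\<close>, the same for every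
    \<sigma>; its missing block vanishes, while that of a competitor is at least zero.\<close>
  have "(norm (Y\<^sub>o - X\<^sub>o *v ?b))\<^sup>2 + (norm (X\<^sub>m *v ?b - X\<^sub>m *v ?b))\<^sup>2
    \<le> (norm (Y\<^sub>o - X\<^sub>o *v \<beta>))\<^sup>2 + (norm (\<beta>\<^sub>m - X\<^sub>m *v \<beta>))\<^sup>2"
    using least_squares_estimate_minimal[OF assms, of Y\<^sub>o \<beta>] by (simp add: add_increasing2)
  then show "missing_likelihood X\<^sub>o X\<^sub>m Y\<^sub>o \<beta> \<beta>\<^sub>m \<sigma>
      \<le> missing_likelihood X\<^sub>o X\<^sub>m Y\<^sub>o ?b (X\<^sub>m *v ?b) \<sigma>"
    \<comment> \<open>The negative factor \<open>- (1 / (2 * \<sigma>\<^sup>2))\<close> reverses the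
      inequality; \<open>exp\<close> and the positive prefactor preserve it.\<close>
    unfolding missing_likelihood_eq using \<open>\<sigma> > 0\<close>
    by (intro mult_left_mono iffD2[OF exp_le_cancel_iff] mult_left_mono_neg) auto
qed

end
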